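(* Let $A=\{a_1,a_2,\ldots,a_k\}$, $a_1<\cdots<a_k$, be any ordered set of positive integers, and let $\tau,\nu$ be consecutive patterns. (1) Let $\phi$ be the shuffle pattern $\tau\text{-}\ell\text{-}\nu$, in which $\ell$ is the greatest element. Then for all $k\geq \ell$, $$C_\phi^A(x,y)=\frac{C_\phi^{A-\{a_k\}}(x,y)-x^{a_k}y\,C_\tau^{A-\{a_k\}}(x,y)\,C_\nu^{A-\{a_k\}}(x,y)}{\left(1-x^{a_k}y\,C_\tau^{A-\{a_k\}}(x,y)\right)\left(1-x^{a_k}y\,C_\nu^{A-\{a_k\}}(x,y)\right)}.$$ (2) Let $\psi$ be the shuffle pattern $\tau\text{-}1\text{-}\nu$, in which $1$ is the smallest element. Then for all $k\geq \ell$, $$C_\psi^A(x,y)=\frac{C_\psi^{A-\{a_1\}}(x,y)-x^{a_1}y\,C_\tau^{A-\{a_1\}}(x,y)\,C_\nu^{A-\{a_1\}}(x,y)}{\left(1-x^{a_1}y\,C_\tau^{A-\{a_1\}}(x,y)\right)\left(1-x^{a_1}y\,C_\nu^{A-\{a_1\}}(x,y)\right)}.$$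
   Context: A composition $\sigma=\sigma_1\ldots\sigma_m$ of $n$ with $m$ parts in $A$ is a sequence of $m$ elements of $A$ with sum $n$; the set of these is $C_{n;m}^A$. The empty composition ($n=m=0$) is included (and is the only composition with parts in the empty set). A partially ordered pattern (POP) is a word $\rho_1\ldots\rho_r$ of letters from a partially ordered alphabet (repeated letters allowed), possibly with dashes between some neighbouring letters. An occurrence of $\rho$ in $\sigma$ is a choice of positions $i_1<\cdots<i_r$ such that: $i_{p+1}=i_p+1$ whenever there is no dash between $\rho_p$ and $\rho_{p+1}$; $\sigma_{i_p}=\sigma_{i_q}$ whenever $\rho_p=\rho_q$; and $\sigma_{i_p}<\sigma_{i_q}$ whenever $\rho_p<\rho_q$. Nothing is required for incomparable letters. $\sigma$ avoids $\rho$ if it has no occurrence of $\rho$. $C_{n;m}^A(\rho)$ is the set of $\sigma\in C_{n;m}^A$ avoiding $\rho$, and $C_\rho^A(x,y)=\sum_{n,m\ge0}|C_{n;m}^A(\rho)|x^ny^m$. A consecutive pattern is a dash-free word over a totally ordered alphabet $[t]=\{1,\dots,t\}$ that contains each letter of $[t]$ at least once. The shuffle pattern $\tau\text{-}\ell\text{-}\nu$ is the POP consisting of the word $\tau$, a dash, a single letter $\ell$, a dash, and the word $\nu$, where every letter of $\tau$ is incomparable to every letter of $\nu$, the order inside $\tau$ and inside $\nu$ is kept, and the letter $\ell$ is greater than every letter of $\tau$ and of $\nu$. The shuffle pattern $\tau\text{-}1\text{-}\nu$ is defined in the same way, except that the middle letter is smaller than every letter of $\tau$ and of $\nu$. The number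 $\ell$ in the condition $k\ge\ell$ is the numerical value of the greatest letter of the shuffle pattern: if $\tau$ is a word using exactly the letters $[t]$ and $\nu$ a word using exactly the letters $[u]$, then $\ell=\max(t,u)+1$ (in part (2) the letters of $\tau$ and $\nu$ are shifted up by one so that the middle letter is $1$; e.g. $1'\text{-}2\text{-}1''$ and $2'\text{-}1\text{-}2''$ both have $\ell=2$). *)

theory Defs
  imports "HOL-Computational_Algebra.Formal_Power_Series"
begin

definition compositions :: "nat set \<Rightarrow> nat \<Rightarrow> nat \<Rightarrow> nat list set" where
  "compositions A n m = {\<sigma>. length \<sigma> = m \<and> set \<sigma> \<subseteq> A \<and> sum_list \<sigma> = n}"

text \<open>
  A partially ordered pattern.  Letters are numbered from \<open>0\<close>, and \<open>q \<in> dashes \<rho>\<close> means that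
  there is a dash immediately before letter number \<open>q\<close>.  The field \<open>less_letter\<close> is the strict
  order of the alphabet.
\<close>

record 'l pop =
  letters :: "'l list"
  dashes :: "nat set"
  less_letter :: "'l \<Rightarrow> 'l \<Rightarrow> bool"

definition occurrence :: "'l pop \<Rightarrow> nat list \<Rightarrow> nat list \<Rightarrow> bool" where
  "occurrence \<rho> js \<sigma> \<longleftrightarrow>
     length js = length (letters \<rho>) \<and> sorted_wrt (<) js \<and> set js \<subseteq> {..<length \<sigma>} \<and>
     (\<forall>p. Suc p < length js \<and> Suc p \<notin> dashes \<rho> \<longrightarrow> js ! Suc p = Suc (js ! p)) \<and>
     (\<forall>p < length js. \<forall>q < length js.
        letters \<rho> ! p = letters \<rho> ! q \<longrightarrow> \<sigma> ! (js ! p) = \<sigma> ! (js ! q)) \<and>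
     (\<forall>p < length js. \<forall>q < length js.
        less_letter \<rho> (letters \<rho> ! p) (letters \<rho> ! q) \<longrightarrow> \<sigma> ! (js ! p) < \<sigma> ! (js ! q))"

definition avoids :: "nat list \<Rightarrow> 'l pop \<Rightarrow> bool" where
  "avoids \<sigma> \<rho> \<longleftrightarrow> \<not> (\<exists>js. occurrence \<rho> js \<sigma>)"

text \<open>
  Bivariate series are series in \<open>y\<close> whose coefficients are series in \<open>x\<close>.  A series whose
  coefficient at \<open>y\<^sup>0\<close> is \<open>1\<close> is invertible here, and division by it is the genuine one.
\<close>

abbreviation var_x :: "rat fps fps" where
  "var_x \<equiv> fps_const fps_X"

abbreviation var_y :: "rat fps fps" where
  "var_y \<equiv> fps_X"

lemma divide_mult_cancel_of_nth_0:
  fixes f g :: "rat fps fps"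
  assumes "fps_nth g 0 = 1"
  shows "f / g * g = f"
proof -
  have "subdegree g = 0" and "unit_factor g = g"
    using assms by (auto simp: subdegree_eq_0_iff)
  moreover have "g * inverse g = 1"
    unfolding fps_inverse_def using assms by (intro fps_right_inverse) simp
  ultimately show ?thesis
    by (simp add: fps_divide_def mult.assoc mult.commute[of _ g])
qed

definition avoid_gf :: "'l pop \<Rightarrow> nat set \<Rightarrow> rat fps fps" where
  "avoid_gf \<rho> A =
     Abs_fps (\<lambda>m. Abs_fps (\<lambda>n. of_nat (card {\<sigma> \<in> compositions A n m. avoids \<sigma> \<rho>})))"

definition consecutive_word :: "nat \<Rightarrow> nat list \<Rightarrow> bool" where
  "consecutive_word t \<tau> \<longleftrightarrow> set \<tau> = {1..t}"

definition consecutive_pop :: "nat list \<Rightarrow> nat pop" where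
  "consecutive_pop \<tau> = \<lparr>letters = \<tau>, dashes = {}, less_letter = (<)\<rparr>"

text \<open>
  The alphabet of a shuffle pattern: disjoint copies of the alphabets of \<open>\<tau>\<close> and \<open>\<nu>\<close>, and the
  middle letter.  Only the order matters, so the letters of \<open>\<tau>\<close> and \<open>\<nu>\<close> need not be
  shifted when the middle letter is the smallest one.
\<close>

datatype shuffle_letter = Left_Letter nat | Middle_Letter | Right_Letter nat

fun less_middle_greatest :: "shuffle_letter \<Rightarrow> shuffle_letter \<Rightarrow> bool" where
  "less_middle_greatest (Left_Letter i) (Left_Letter j) \<longleftrightarrow> i < j"
| "less_middle_greatest (Right_Letter i) (Right_Letter j) \<longleftrightarrow> i < j"
| "less_middle_greatest (Left_Letter i) Middle_Letter \<longleftrightarrow> True"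
| "less_middle_greatest (Right_Letter i) Middle_Letter \<longleftrightarrow> True"
| "less_middle_greatest _ _ \<longleftrightarrow> False"

fun less_middle_smallest :: "shuffle_letter \<Rightarrow> shuffle_letter \<Rightarrow> bool" where
  "less_middle_smallest (Left_Letter i) (Left_Letter j) \<longleftrightarrow> i < j"
| "less_middle_smallest (Right_Letter i) (Right_Letter j) \<longleftrightarrow> i < j"
| "less_middle_smallest Middle_Letter (Left_Letter i) \<longleftrightarrow> True"
| "less_middle_smallest Middle_Letter (Right_Letter i) \<longleftrightarrow> True"
| "less_middle_smallest _ _ \<longleftrightarrow> False"

lemma less_middle_greatest_strict_order:
  "irreflp less_middle_greatest" "transp less_middle_greatest"
proof -
  show "irreflp less_middle_greatest"
    by (rule irreflpI) (metis less_irrefl less_middle_greatest.simps shuffle_letter.exhaust)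
  show "transp less_middle_greatest"
  proof (rule transpI)
    fix a b c
    assume "less_middle_greatest a b" "less_middle_greatest b c"
    then show "less_middle_greatest a c"
      by (cases a; cases b; cases c) auto
  qed
qed

lemma less_middle_smallest_strict_order:
  "irreflp less_middle_smallest" "transp less_middle_smallest"
proof -
  show "irreflp less_middle_smallest"
    by (rule irreflpI) (metis less_irrefl less_middle_smallest.simps shuffle_letter.exhaust)
  show "transp less_middle_smallest"
  proof (rule transpI)
    fix a b c
    assume "less_middle_smallest a b" "less_middle_smallest b c"
    then show "less_middle_smallest a c"
      by (cases a; cases b; cases c) auto
  qed
qed

definition shuffle_pop ::
    "(shuffle_letter \<Rightarrow> shuffle_letter \<Rightarrow> bool) \<Rightarrow> nat list \<Rightarrow> nat list \<Rightarrow> shuffle_letter pop" where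
  "shuffle_pop lt \<tau> \<nu> =
     \<lparr>letters = map Left_Letter \<tau> @ [Middle_Letter] @ map Right_Letter \<nu>,
      dashes = {length \<tau>, Suc (length \<tau>)},
      less_letter = lt\<rparr>"

definition shuffle_greatest :: "nat list \<Rightarrow> nat list \<Rightarrow> shuffle_letter pop" where
  "shuffle_greatest = shuffle_pop less_middle_greatest"

definition shuffle_smallest :: "nat list \<Rightarrow> nat list \<Rightarrow> shuffle_letter pop" where
  "shuffle_smallest = shuffle_pop less_middle_smallest"

end

theory Submission
  imports Defs "HOL-Library.Sublist"
begin

text \<open>
  Let \<open>M\<close> be the extreme letter of the alphabet \<open>A\<close> (the greatest for \<open>\<tau>-\<ell>-\<nu>\<close>, the smallest for
  \<open>\<tau>-1-\<nu>\<close>), let \<open>B = A - {M}\<close>, and let \<open>\<phi>\<close> be the shuffle pattern.  A word over \<open>A\<close> either has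
  all its letters in \<open>B\<close> or is uniquely \<open>w M r\<close>, with \<open>w\<close> over \<open>B\<close> and \<open>r\<close> over \<open>A\<close>.  Both outer
  blocks of an occurrence of \<open>\<phi>\<close> are contiguous and consist of letters strictly on one side of the
  middle letter; hence neither can contain \<open>M\<close>, and each lies inside \<open>w\<close> or inside \<open>r\<close>.
  It follows that \<open>w M r\<close> contains \<open>\<phi>\<close> iff \<open>w\<close> does, or \<open>r\<close> does, or \<open>w\<close> contains \<open>\<tau>\<close> and \<open>r\<close>
  contains an occurrence of \<open>\<nu>\<close> without \<open>M\<close> (lemma \<open>shuffle_occurs_split\<close>).

  Write \<open>z = x\<^sup>M y\<close>, and let \<open>C\<close>, \<open>F\<close> count the words avoiding \<open>\<phi>\<close> over \<open>A\<close> and over \<open>B\<close>, let \<open>T\<close>,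
  \<open>N\<close> count the words over \<open>B\<close> avoiding \<open>\<tau>\<close>, respectively \<open>\<nu>\<close>, and let \<open>E\<close> count the words over \<open>A\<close> in which
  every occurrence of \<open>\<nu>\<close> uses \<open>M\<close>.  Distinguishing whether \<open>w\<close> avoids \<open>\<tau>\<close> gives
  \<open>C = F + z T C + z (F - T) E\<close>, and cutting at the first \<open>M\<close> gives \<open>E = N + z N E\<close>.
  Eliminating \<open>E\<close> yields \<open>C (1 - z T) (1 - z N) = F - z T N\<close>.

  The two parts differ only in the direction of the order, so the argument is carried out for a
  relation \<open>R\<close> that stands for \<open><\<close> in the first part and for \<open>>\<close> in the second.
\<close>

section \<open>Occurrences as factors of words\<close>

text \<open>
  Pairing each pattern letter with the letter of the word assigned to it, instead of comparing by
  position, makes the condition decompose along concatenations of patterns.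
\<close>

definition matches :: "('l \<Rightarrow> 'l \<Rightarrow> bool) \<Rightarrow> 'l list \<Rightarrow> nat list \<Rightarrow> bool" where
  "matches lt L xs \<longleftrightarrow> length xs = length L \<and>
     (\<forall>(l, x) \<in> set (zip L xs). \<forall>(l', x') \<in> set (zip L xs).
        (l = l' \<longrightarrow> x = x') \<and> (lt l l' \<longrightarrow> x < x'))"

definition contains :: "nat list \<Rightarrow> nat list \<Rightarrow> bool" where
  "contains \<tau> w \<longleftrightarrow> (\<exists>v. sublist v w \<and> matches (<) \<tau> v)"

text \<open>
  "Below" refers to \<open>R\<close>: if \<open>R\<close> is \<open>>\<close>, the letters of the occurrence exceed \<open>m\<close>.  The relation does
  not affect the order inside the factor, which is the usual one in both cases.
\<close>

definition contains_below :: "(nat \<Rightarrow> nat \<Rightarrow> bool) \<Rightarrow> nat list \<Rightarrow> nat \<Rightarrow> nat list \<Rightarrow> bool" where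
  "contains_below R \<tau> m w \<longleftrightarrow> (\<exists>v. sublist v w \<and> matches (<) \<tau> v \<and> (\<forall>x \<in> set v. R x m))"

definition shuffle_occurs ::
    "(nat \<Rightarrow> nat \<Rightarrow> bool) \<Rightarrow> nat list \<Rightarrow> nat list \<Rightarrow> nat list \<Rightarrow> bool" where
  "shuffle_occurs R \<tau> \<nu> w \<longleftrightarrow>
     (\<exists>us m vs. w = us @ m # vs \<and> contains_below R \<tau> m us \<and> contains_below R \<nu> m vs)"

definition consecutive :: "nat list \<Rightarrow> bool" where
  "consecutive js \<longleftrightarrow> (\<forall>p. Suc p < length js \<longrightarrow> js ! Suc p = Suc (js ! p))"

lemma matches_nth:
  "matches lt L xs \<longleftrightarrow> length xs = length L \<and>
     (\<forall>p < length xs. \<forall>q < length xs.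
        (L ! p = L ! q \<longrightarrow> xs ! p = xs ! q) \<and> (lt (L ! p) (L ! q) \<longrightarrow> xs ! p < xs ! q))"
  by (cases "length xs = length L") (simp_all add: matches_def all_set_conv_all_nth)

lemma occurrence_iff_matches:
  "occurrence \<rho> js \<sigma> \<longleftrightarrow>
     sorted_wrt (<) js \<and> set js \<subseteq> {..<length \<sigma>} \<and>
     (\<forall>p. Suc p < length js \<and> Suc p \<notin> dashes \<rho> \<longrightarrow> js ! Suc p = Suc (js ! p)) \<and>
     matches (less_letter \<rho>) (letters \<rho>) (map ((!) \<sigma>) js)"
  unfolding occurrence_def matches_nth
  by (cases "length js = length (letters \<rho>)") (simp_all, meson)

lemma consecutive_upt:
  assumes "consecutive js"
  shows "js = [hd js..<hd js + length js]"
proof -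
  have "p < length js \<Longrightarrow> js ! p = hd js + p" for p
    using assms unfolding consecutive_def by (induction p) (auto simp: hd_conv_nth)
  then show ?thesis
    by (intro nth_equalityI) auto
qed

lemma consecutive_sorted: "consecutive js \<Longrightarrow> sorted_wrt (<) js"
  by (metis consecutive_upt sorted_wrt_upt)

text \<open>
  A contiguous block of positions inside the segment \<open>us\<close> of a word reads a factor of \<open>us\<close>, and every
  factor is read in this way.  The context \<open>ps\<close>, \<open>ss\<close> lets the blocks on both sides of the middle
  letter be located in the whole word.
\<close>

lemma sublist_iff_positions:
  "sublist v us \<longleftrightarrow>
     (\<exists>js. consecutive js \<and> set js \<subseteq> {length ps..<length ps + length us} \<and>
           v = map ((!) (ps @ us @ ss)) js)"
proof
  assume "sublist v us"
  then obtain a b where us: "us = a @ v @ b"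
    by (auto simp: sublist_def)
  define js where "js = [length ps + length a..<length ps + length a + length v]"
  have "v = map ((!) (ps @ us @ ss)) js"
    by (intro nth_equalityI) (auto simp: js_def us nth_append)
  moreover have "consecutive js" "set js \<subseteq> {length ps..<length ps + length us}"
    by (auto simp: js_def us consecutive_def)
  ultimately show "\<exists>js. consecutive js \<and> set js \<subseteq> {length ps..<length ps + length us} \<and>
      v = map ((!) (ps @ us @ ss)) js"
    by blast
next
  assume "\<exists>js. consecutive js \<and> set js \<subseteq> {length ps..<length ps + length us} \<and>
      v = map ((!) (ps @ us @ ss)) js"
  then obtain js where js: "consecutive js" "set js \<subseteq> {length ps..<length ps + length us}"
      and v: "v = map ((!) (ps @ us @ ss)) js"
    by blast
  show "sublist v us"
  proof (cases "js = []")
    case True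
    then show ?thesis
      by (simp add: v)
  next
    case False
    define c n where "c = hd js" and "n = length js"
    have upt: "js = [c..<c + n]"
      unfolding c_def n_def using js(1) by (rule consecutive_upt)
    have "n > 0"
      using False by (simp add: n_def)
    then have "c \<in> set js" "c + n - 1 \<in> set js"
      by (auto simp: upt)
    then have "c \<in> {length ps..<length ps + length us}"
        "c + n - 1 \<in> {length ps..<length ps + length us}"
      using js(2) by blast+
    then have bounds: "length ps \<le> c" "c + n \<le> length ps + length us"
      by auto
    have "v = take n (drop (c - length ps) us)"
      using bounds by (intro nth_equalityI) (auto simp: v upt nth_append less_diff_conv)
    then show ?thesis
      by (metis append_take_drop_id sublist_appendI)
  qed
qed

lemma avoids_consecutive_iff: "avoids \<sigma> (consecutive_pop \<tau>) \<longleftrightarrow> \<not> contains \<tau> \<sigma>"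
proof -
  have "occurrence (consecutive_pop \<tau>) js \<sigma> \<longleftrightarrow>
      consecutive js \<and> set js \<subseteq> {..<length \<sigma>} \<and> matches (<) \<tau> (map ((!) \<sigma>) js)" for js
    using consecutive_sorted[of js]
    by (simp add: occurrence_iff_matches consecutive_pop_def consecutive_def[symmetric]) blast
  then show ?thesis
    unfolding avoids_def contains_def sublist_iff_positions[of _ _ "[]" "[]"]
    by (simp add: lessThan_atLeast0) blast
qed

lemma consecutive_blocks:
  assumes "length is = n"
  shows "(\<forall>p. Suc p < length (is @ i # js) \<and> Suc p \<notin> {n, Suc n} \<longrightarrow>
            (is @ i # js) ! Suc p = Suc ((is @ i # js) ! p)) \<longleftrightarrow>
         consecutive is \<and> consecutive js"
proof (intro iffI conjI)
  assume *: "\<forall>p. Suc p < length (is @ i # js) \<and> Suc p \<notin> {n, Suc n} \<longrightarrow>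
            (is @ i # js) ! Suc p = Suc ((is @ i # js) ! p)"
  show "consecutive is"
    unfolding consecutive_def
  proof (intro allI impI)
    fix p
    assume "Suc p < length is"
    then show "is ! Suc p = Suc (is ! p)"
      using spec[OF *, of p] assms by (simp add: nth_append)
  qed
  show "consecutive js"
    unfolding consecutive_def
  proof (intro allI impI)
    fix p
    assume "Suc p < length js"
    then show "js ! Suc p = Suc (js ! p)"
      using spec[OF *, of "Suc n + p"] assms by (simp add: nth_append)
  qed
next
  assume *: "consecutive is \<and> consecutive js"
  show "\<forall>p. Suc p < length (is @ i # js) \<and> Suc p \<notin> {n, Suc n} \<longrightarrow>
            (is @ i # js) ! Suc p = Suc ((is @ i # js) ! p)"
  proof (intro allI impI)
    fix p
    assume p: "Suc p < length (is @ i # js) \<and> Suc p \<notin> {n, Suc n}"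
    show "(is @ i # js) ! Suc p = Suc ((is @ i # js) ! p)"
    proof (cases "Suc p < n")
      case True
      then show ?thesis
        using * assms by (simp add: nth_append consecutive_def)
    next
      case False
      then obtain q where "p = Suc n + q"
        using p by (metis insertCI le_Suc_ex less_SucE not_less_eq not_less)
      then show ?thesis
        using * p assms by (simp add: nth_append consecutive_def)
    qed
  qed
qed

text \<open>
  The letters of \<open>\<tau>\<close> are distinct from and incomparable to those of \<open>\<nu>\<close>, so the two outer words are
  matched independently of each other and interact only with the middle letter.  All outer letters
  compare to the middle one in the same way, so \<open>R\<close> expresses this interaction for both words.
\<close>

lemma matches_shuffle_word:
  fixes lt :: "shuffle_letter \<Rightarrow> shuffle_letter \<Rightarrow> bool"
  assumes len: "length xs = length \<tau>" "length ys = length \<nu>"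
    and outer: "\<And>i j. lt (Left_Letter i) (Left_Letter j) \<longleftrightarrow> i < j"
      "\<And>i j. lt (Right_Letter i) (Right_Letter j) \<longleftrightarrow> i < j"
      "\<And>i j. \<not> lt (Left_Letter i) (Right_Letter j)"
      "\<And>i j. \<not> lt (Right_Letter i) (Left_Letter j)"
      "\<not> lt Middle_Letter Middle_Letter"
    and middle: "\<And>i x. R x m \<longleftrightarrow> (lt (Left_Letter i) Middle_Letter \<longrightarrow> x < m) \<and>
        (lt Middle_Letter (Left_Letter i) \<longrightarrow> m < x)"
      "\<And>i x. R x m \<longleftrightarrow> (lt (Right_Letter i) Middle_Letter \<longrightarrow> x < m) \<and>
        (lt Middle_Letter (Right_Letter i) \<longrightarrow> m < x)"
  shows "matches lt (map Left_Letter \<tau> @ [Middle_Letter] @ map Right_Letter \<nu>) (xs @ m # ys) \<longleftrightarrow>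
     matches (<) \<tau> xs \<and> matches (<) \<nu> ys \<and> (\<forall>x \<in> set xs. R x m) \<and> (\<forall>y \<in> set ys. R y m)"
proof -
  define X Y where "X = set (zip \<tau> xs)" and "Y = set (zip \<nu> ys)"
  have Z: "set (zip (map Left_Letter \<tau> @ [Middle_Letter] @ map Right_Letter \<nu>) (xs @ m # ys)) =
      (\<lambda>(i, x). (Left_Letter i, x)) ` X \<union> {(Middle_Letter, m)} \<union> (\<lambda>(i, x). (Right_Letter i, x)) ` Y"
    using len by (auto simp: X_def Y_def zip_map1)
  have xs: "set xs = snd ` X" and ys: "set ys = snd ` Y"
    using len by (simp_all add: X_def Y_def flip: set_map)
  have m: "(\<forall>x \<in> set xs. R x m) \<longleftrightarrow> (\<forall>(i, x) \<in> X. (lt (Left_Letter i) Middle_Letter \<longrightarrow> x < m) \<and>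
      (lt Middle_Letter (Left_Letter i) \<longrightarrow> m < x))"
    "(\<forall>y \<in> set ys. R y m) \<longleftrightarrow> (\<forall>(i, x) \<in> Y. (lt (Right_Letter i) Middle_Letter \<longrightarrow> x < m) \<and>
      (lt Middle_Letter (Right_Letter i) \<longrightarrow> m < x))"
    unfolding xs ys by (auto simp flip: middle)
  show ?thesis
    unfolding matches_def Z m X_def[symmetric] Y_def[symmetric]
    using len by (simp add: ball_Un split_beta outer) blast
qed

text \<open>
  The two dashes are exactly the gaps next to the middle letter, so the positions of an occurrence
  form a contiguous block, one free position, and another contiguous block.  An empty outer word
  imposes no condition; it corresponds to the empty factor.
\<close>

lemma avoids_shuffle_iff:
  assumes matches_iff: "\<And>xs m ys. length xs = length \<tau> \<Longrightarrow> length ys = length \<nu> \<Longrightarrow>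
      matches lt (map Left_Letter \<tau> @ [Middle_Letter] @ map Right_Letter \<nu>) (xs @ m # ys) \<longleftrightarrow>
      matches (<) \<tau> xs \<and> matches (<) \<nu> ys \<and> (\<forall>x \<in> set xs. R x m) \<and> (\<forall>y \<in> set ys. R y m)"
  shows "avoids \<sigma> (shuffle_pop lt \<tau> \<nu>) \<longleftrightarrow> \<not> shuffle_occurs R \<tau> \<nu> \<sigma>"
proof -
  have occ: "occurrence (shuffle_pop lt \<tau> \<nu>) (is @ i # js) \<sigma> \<longleftrightarrow>
      consecutive is \<and> set is \<subseteq> {..<i} \<and> i < length \<sigma> \<and>
      consecutive js \<and> set js \<subseteq> {Suc i..<length \<sigma>} \<and>
      matches (<) \<tau> (map ((!) \<sigma>) is) \<and> matches (<) \<nu> (map ((!) \<sigma>) js) \<and>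
      (\<forall>x \<in> set (map ((!) \<sigma>) is). R x (\<sigma> ! i)) \<and> (\<forall>y \<in> set (map ((!) \<sigma>) js). R y (\<sigma> ! i))"
    if "length is = length \<tau>" "length js = length \<nu>" for "is" i js
  proof -
    have "sorted_wrt (<) (is @ i # js) \<and> set (is @ i # js) \<subseteq> {..<length \<sigma>} \<longleftrightarrow>
        set is \<subseteq> {..<i} \<and> i < length \<sigma> \<and> set js \<subseteq> {Suc i..<length \<sigma>}"
      if "consecutive is" "consecutive js"
      using that[THEN consecutive_sorted]
      by (force simp: sorted_wrt_append)
    then show ?thesis
      using that matches_iff[of "map ((!) \<sigma>) is" "map ((!) \<sigma>) js" "\<sigma> ! i"]
        consecutive_blocks[of "is" "length \<tau>" i js]
      unfolding occurrence_iff_matches shuffle_pop_def pop.simps map_append list.map length_map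
      by blast
  qed
  have "shuffle_occurs R \<tau> \<nu> \<sigma>" if "occurrence (shuffle_pop lt \<tau> \<nu>) ks \<sigma>" for ks
  proof -
    define "is" i js where "is = take (length \<tau>) ks" and "i = ks ! length \<tau>"
      and "js = drop (Suc (length \<tau>)) ks"
    have "length ks = Suc (length \<tau> + length \<nu>)"
      using that by (simp add: occurrence_def shuffle_pop_def)
    then have ks: "ks = is @ i # js" "length is = length \<tau>" "length js = length \<nu>"
      by (auto simp: is_def i_def js_def id_take_nth_drop[symmetric])
    define us m vs where "us = take i \<sigma>" and "m = \<sigma> ! i" and "vs = drop (Suc i) \<sigma>"
    note * = that[unfolded ks(1) occ[OF ks(2,3)]]
    then have \<sigma>: "\<sigma> = us @ m # vs" and i: "length us = i" "length \<sigma> = Suc (i + length vs)"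
      by (auto simp: us_def m_def vs_def id_take_nth_drop[symmetric])
    have "sublist (map ((!) \<sigma>) is) us"
      unfolding sublist_iff_positions[of _ us "[]" "m # vs"] using * \<sigma> i
      by (auto intro!: exI[of _ "is"])
    moreover have "sublist (map ((!) \<sigma>) js) vs"
      unfolding sublist_iff_positions[of _ vs "us @ [m]" "[]"] using * \<sigma> i
      by (auto intro!: exI[of _ js])
    ultimately have "contains_below R \<tau> m us" "contains_below R \<nu> m vs"
      using * unfolding contains_below_def m_def by blast+
    then show ?thesis
      unfolding shuffle_occurs_def using \<sigma> by blast
  qed
  moreover have "\<exists>ks. occurrence (shuffle_pop lt \<tau> \<nu>) ks \<sigma>" if "shuffle_occurs R \<tau> \<nu> \<sigma>"
  proof -
    from that obtain us m vs where \<sigma>: "\<sigma> = us @ m # vs"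
      and "contains_below R \<tau> m us" and "contains_below R \<nu> m vs"
      unfolding shuffle_occurs_def by blast
    then obtain xs ys where xs: "sublist xs us" "matches (<) \<tau> xs" "\<forall>x \<in> set xs. R x m"
      and ys: "sublist ys vs" "matches (<) \<nu> ys" "\<forall>y \<in> set ys. R y m"
      unfolding contains_below_def by blast
    obtain "is" where "is": "consecutive is" "set is \<subseteq> {..<length us}" "xs = map ((!) \<sigma>) is"
      using xs(1) unfolding sublist_iff_positions[of _ us "[]" "m # vs"] \<sigma>
      by (auto simp: lessThan_atLeast0)
    obtain js where js: "consecutive js" "set js \<subseteq> {Suc (length us)..<length \<sigma>}"
        "ys = map ((!) \<sigma>) js"
      using ys(1) unfolding sublist_iff_positions[of _ vs "us @ [m]" "[]"] \<sigma> by auto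
    have len: "length is = length \<tau>" "length js = length \<nu>"
      using xs(2) ys(2) "is"(3) js(3) by (auto simp: matches_def)
    have "\<sigma> ! length us = m" "length us < length \<sigma>"
      by (simp_all add: \<sigma>)
    then have "occurrence (shuffle_pop lt \<tau> \<nu>) (is @ length us # js) \<sigma>"
      unfolding occ[OF len] using "is" js xs ys by metis
    then show ?thesis ..
  qed
  ultimately show ?thesis
    unfolding avoids_def by blast
qed

lemma avoids_shuffle_greatest_iff:
  "avoids \<sigma> (shuffle_greatest \<tau> \<nu>) \<longleftrightarrow> \<not> shuffle_occurs (<) \<tau> \<nu> \<sigma>"
  unfolding shuffle_greatest_def
  by (intro avoids_shuffle_iff matches_shuffle_word) simp_all

lemma avoids_shuffle_smallest_iff:
  "avoids \<sigma> (shuffle_smallest \<tau> \<nu>) \<longleftrightarrow> \<not> shuffle_occurs (>) \<tau> \<nu> \<sigma>"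
  unfolding shuffle_smallest_def
  by (intro avoids_shuffle_iff matches_shuffle_word) simp_all

section \<open>Cutting a word at its first extreme letter\<close>

lemma sublist_tail: "sublist vs (us @ m # vs)"
  using sublist_append_leftI[of vs "us @ [m]"] by simp

lemma contains_below_mono:
  assumes "contains_below R \<tau> m us" "sublist us ws" "\<And>x. R x m \<Longrightarrow> R x n"
  shows "contains_below R \<tau> n ws"
proof -
  obtain v where v: "sublist v us" "matches (<) \<tau> v" "\<forall>x \<in> set v. R x m"
    using assms(1) unfolding contains_below_def by blast
  moreover have "sublist v ws"
    using v(1) assms(2) by (rule sublist_order.order_trans)
  ultimately show ?thesis
    unfolding contains_below_def using assms(3) by blast
qed

lemma contains_below_lists:
  assumes w: "w \<in> lists B" and below: "\<And>b. b \<in> B \<Longrightarrow> R b M"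
  shows "contains_below R \<tau> M w \<longleftrightarrow> contains \<tau> w"
proof -
  have "\<forall>x \<in> set v. R x M" if "sublist v w" for v
    using set_mono_sublist[OF that] w below by auto
  then show ?thesis
    unfolding contains_below_def contains_def by blast
qed

text \<open>
  An occurrence whose letters are all \<open>R\<close>-related to \<open>m\<close> cannot use the letter \<open>M\<close>, so it lies on
  one side of every \<open>M\<close>.
\<close>

lemma contains_below_append_Cons:
  assumes "\<not> R M m"
  shows "contains_below R \<tau> m (us @ M # vs) \<longleftrightarrow>
    contains_below R \<tau> m us \<or> contains_below R \<tau> m vs"
proof -
  have split: "sublist v us \<or> sublist v vs" if v: "sublist v (us @ M # vs)" "\<forall>x \<in> set v. R x m" for v
  proof -
    have "M \<notin> set v"
      using assms v(2) by blast
    then have nil: "v' = []" if "prefix v' (M # vs)" "set v' \<subseteq> set v" for v'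
      using that by (auto simp: prefix_Cons)
    consider "sublist v us" | "sublist v (M # vs)"
      | v1 v2 where "v = v1 @ v2" "suffix v1 us" "prefix v2 (M # vs)"
      using v(1) unfolding sublist_append by blast
    then show ?thesis
    proof cases
      case 2
      then show ?thesis
        using nil[of v] by (auto simp: sublist_Cons_right)
    next
      case 3
      then show ?thesis
        using nil[of v2] suffix_imp_sublist by auto
    qed simp
  qed
  show ?thesis
  proof
    assume "contains_below R \<tau> m (us @ M # vs)"
    then show "contains_below R \<tau> m us \<or> contains_below R \<tau> m vs"
      unfolding contains_below_def using split by blast
  next
    assume "contains_below R \<tau> m us \<or> contains_below R \<tau> m vs"
    then show "contains_below R \<tau> m (us @ M # vs)"
      by (elim disjE) (erule contains_below_mono, simp_all add: sublist_tail)+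
  qed
qed

lemma contains_below_imp_contains: "contains_below R \<tau> m w \<Longrightarrow> contains \<tau> w"
  unfolding contains_below_def contains_def by blast

lemma shuffle_occurs_imp_contains:
  assumes "shuffle_occurs R \<tau> \<nu> w"
  shows "contains \<tau> w"
proof -
  obtain us m vs where "w = us @ m # vs" "contains_below R \<tau> m us"
    using assms unfolding shuffle_occurs_def by blast
  then have "contains_below R \<tau> m w"
    by (auto intro: contains_below_mono)
  then show ?thesis
    by (rule contains_below_imp_contains)
qed

text \<open>
  The letter \<open>M\<close> is extreme for the order \<open>R\<close> in the alphabet \<open>insert M B\<close>.  Taking \<open>R\<close> as a parameter
  treats a greatest and a smallest letter at once.
\<close>

locale extreme_letter =
  fixes R :: "nat \<Rightarrow> nat \<Rightarrow> bool" and B :: "nat set" and M :: nat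
  assumes trans: "transp R" and irrefl: "irreflp R"
    and extreme: "\<And>b. b \<in> B \<Longrightarrow> R b M"
    and finite_letters: "finite B"
begin

abbreviation A :: "nat set" where
  "A \<equiv> insert M B"

lemma M_notin: "M \<notin> B"
  using irrefl extreme by (auto dest: irreflpD)

lemma not_R_M: "a \<in> A \<Longrightarrow> \<not> R M a"
  using trans irrefl extreme by (metis insertE irreflpD transpD)

lemma contains_below_cut:
  assumes "m \<in> A"
  shows "contains_below R \<tau> m (us @ M # vs) \<longleftrightarrow>
    contains_below R \<tau> m us \<or> contains_below R \<tau> m vs"
  using assms by (intro contains_below_append_Cons not_R_M)

lemma contains_below_M:
  "w \<in> lists B \<Longrightarrow> contains_below R \<tau> M w \<longleftrightarrow> contains \<tau> w"
  by (rule contains_below_lists[where B = B]) (simp_all add: extreme)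

lemma R_M_if_R: "a \<in> A \<Longrightarrow> R x a \<Longrightarrow> R x M"
  using trans extreme by (metis insertE transpD)

lemma shuffle_occurs_imp_contains_below:
  assumes "w \<in> lists A" "shuffle_occurs R \<tau> \<nu> w"
  shows "contains_below R \<nu> M w"
proof -
  obtain us m vs where w: "w = us @ m # vs" and "contains_below R \<nu> m vs"
    using assms(2) unfolding shuffle_occurs_def by blast
  moreover have "sublist vs w"
    by (simp add: w sublist_tail)
  moreover have "m \<in> A"
    using assms(1) by (simp add: w)
  ultimately show ?thesis
    using R_M_if_R by (blast intro: contains_below_mono)
qed

text \<open>
  The position of the middle letter relative to the cut decides which blocks lie on which side.
  If \<open>\<tau>\<close> occurs in \<open>w\<close> and \<open>\<nu>\<close> in \<open>r\<close> without \<open>M\<close>, then \<open>M\<close> itself can serve as the middle letter.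
\<close>

lemma shuffle_occurs_split:
  assumes w: "w \<in> lists B" and r: "r \<in> lists A"
  shows "shuffle_occurs R \<tau> \<nu> (w @ M # r) \<longleftrightarrow>
    shuffle_occurs R \<tau> \<nu> w \<or> shuffle_occurs R \<tau> \<nu> r \<or> contains \<tau> w \<and> contains_below R \<nu> M r"
proof
  assume "shuffle_occurs R \<tau> \<nu> (w @ M # r)"
  then obtain us m vs where cut: "w @ M # r = us @ m # vs"
    and \<tau>: "contains_below R \<tau> m us" and \<nu>: "contains_below R \<nu> m vs"
    unfolding shuffle_occurs_def by blast
  have "w @ M # r \<in> lists A"
    using w r by auto
  then have "m \<in> A"
    by (simp add: cut)
  from cut consider (left) z where "w = us @ m # z" "vs = z @ M # r"
    | (here) "us = w" "m = M" "vs = r"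
    | (right) z where "us = w @ M # z" "r = z @ m # vs"
    by (auto simp: append_eq_append_conv2 append_eq_Cons_conv Cons_eq_append_conv)
  then show "shuffle_occurs R \<tau> \<nu> w \<or> shuffle_occurs R \<tau> \<nu> r \<or>
      contains \<tau> w \<and> contains_below R \<nu> M r"
  proof cases
    case left
    then have "contains \<tau> w"
      using contains_below_mono[OF \<tau>, of w m] contains_below_imp_contains
      by (metis sublist_append_rightI)
    moreover have "contains_below R \<nu> m z \<or> contains_below R \<nu> M r"
      using \<nu> left \<open>m \<in> A\<close> contains_below_cut R_M_if_R contains_below_mono
      by (metis sublist_order.order_refl)
    ultimately show ?thesis
      using left \<tau> unfolding shuffle_occurs_def by blast
  next
    case here
    then show ?thesis
      using \<tau> \<nu> contains_below_imp_contains by blast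
  next
    case right
    then have "contains_below R \<tau> m w \<or> contains_below R \<tau> m z"
      using \<tau> \<open>m \<in> A\<close> contains_below_cut by metis
    moreover have "contains_below R \<nu> M r"
    proof (rule contains_below_mono[OF \<nu>])
      show "sublist vs r"
        by (simp add: right sublist_tail)
    qed (use R_M_if_R \<open>m \<in> A\<close> in blast)
    ultimately show ?thesis
      using right \<nu> contains_below_imp_contains unfolding shuffle_occurs_def by blast
  qed
next
  assume "shuffle_occurs R \<tau> \<nu> w \<or> shuffle_occurs R \<tau> \<nu> r \<or>
      contains \<tau> w \<and> contains_below R \<nu> M r"
  then consider (left) us m z where "w = us @ m # z"
      "contains_below R \<tau> m us" "contains_below R \<nu> m z"
    | (right) z m vs where "r = z @ m # vs" "contains_below R \<tau> m z" "contains_below R \<nu> m vs"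
    | (here) "contains_below R \<tau> M w" "contains_below R \<nu> M r"
    unfolding shuffle_occurs_def contains_below_M[OF w] by blast
  then show "shuffle_occurs R \<tau> \<nu> (w @ M # r)"
  proof cases
    case left
    then have "contains_below R \<nu> m (z @ M # r)"
      by (blast intro: contains_below_mono sublist_append_rightI)
    then show ?thesis
      using left unfolding shuffle_occurs_def by (metis append_Cons append_assoc)
  next
    case right
    then have "contains_below R \<tau> m (w @ M # z)"
      by (metis append_Cons append_Nil append_assoc contains_below_mono sublist_append_leftI)
    then show ?thesis
      using right unfolding shuffle_occurs_def by (metis append_Cons append_assoc)
  next
    case here
    then show ?thesis
      unfolding shuffle_occurs_def by blast
  qed
qed

end

section \<open>Generating functions of sets of words\<close>

text \<open>
  Summing the monomials \<open>x\<^sup>n y\<^sup>m\<close> over the words, rather than counting the words of each kind, turns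
  a bijection between sets of words directly into an identity of series.  Sums over infinite sets
  are \<open>0\<close> by convention, so the laws below ask for a finite alphabet.
\<close>

definition words_gf :: "nat list set \<Rightarrow> rat fps fps" where
  "words_gf S = Abs_fps (\<lambda>m. \<Sum>\<sigma> \<in> {\<sigma> \<in> S. length \<sigma> = m}. fps_X ^ sum_list \<sigma>)"

lemma words_gf_nth: "fps_nth (words_gf S) m = (\<Sum>\<sigma> \<in> {\<sigma> \<in> S. length \<sigma> = m}. fps_X ^ sum_list \<sigma>)"
  by (simp add: words_gf_def)

lemma finite_lists_length:
  assumes "finite B" "S \<subseteq> lists B"
  shows "finite {\<sigma> \<in> S. length \<sigma> = m}"
  by (rule finite_subset[OF _ finite_lists_length_eq[OF assms(1), of m]]) (use assms in auto)

lemma avoid_gf_eq_words_gf: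
  assumes "finite A"
  shows "avoid_gf \<rho> A = words_gf {\<sigma> \<in> lists A. avoids \<sigma> \<rho>}"
proof (intro fps_ext)
  fix m n
  define S where "S = {\<sigma> \<in> {\<sigma> \<in> lists A. avoids \<sigma> \<rho>}. length \<sigma> = m}"
  have "finite S"
    unfolding S_def using assms by (rule finite_lists_length) auto
  have "fps_nth (fps_nth (words_gf {\<sigma> \<in> lists A. avoids \<sigma> \<rho>}) m) n =
      (\<Sum>\<sigma> \<in> S. if sum_list \<sigma> = n then 1 else 0)"
    by (simp add: words_gf_nth fps_sum_nth S_def eq_commute)
  also have "\<dots> = of_nat (card {\<sigma> \<in> S. sum_list \<sigma> = n})"
    using \<open>finite S\<close> by (simp add: sum.If_cases Int_def)
  also have "{\<sigma> \<in> S. sum_list \<sigma> = n} = {\<sigma> \<in> compositions A n m. avoids \<sigma> \<rho>}"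
    by (auto simp: S_def compositions_def)
  finally show "fps_nth (fps_nth (avoid_gf \<rho> A) m) n =
      fps_nth (fps_nth (words_gf {\<sigma> \<in> lists A. avoids \<sigma> \<rho>}) m) n"
    by (simp add: avoid_gf_def)
qed

lemma words_gf_Un:
  assumes "finite A" "S \<subseteq> lists A" "T \<subseteq> lists A" "S \<inter> T = {}"
  shows "words_gf (S \<union> T) = words_gf S + words_gf T"
proof (rule fps_ext)
  fix m
  have "{\<sigma> \<in> S \<union> T. length \<sigma> = m} = {\<sigma> \<in> S. length \<sigma> = m} \<union> {\<sigma> \<in> T. length \<sigma> = m}"
    by blast
  then show "fps_nth (words_gf (S \<union> T)) m = fps_nth (words_gf S + words_gf T) m"
    using assms by (auto simp: words_gf_nth finite_lists_length intro!: sum.union_disjoint)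
qed

definition join :: "nat \<Rightarrow> nat list set \<Rightarrow> nat list set \<Rightarrow> nat list set" where
  "join M S T = (\<lambda>(u, v). u @ M # v) ` (S \<times> T)"

lemma append_Cons_eq_append_Cons:
  assumes "M \<notin> set u" "M \<notin> set u'"
  shows "u @ M # v = u' @ M # v' \<longleftrightarrow> u = u' \<and> v = v'"
  using assms by (auto simp: append_eq_append_conv2 append_eq_Cons_conv Cons_eq_append_conv)

text \<open>
  As \<open>M\<close> does not occur in the words of \<open>S\<close>, the first \<open>M\<close> of a joined word marks where it was
  joined, so each word of \<open>join M S T\<close> arises exactly once.
\<close>

lemma words_gf_join:
  assumes "finite A" "S \<subseteq> lists A" "T \<subseteq> lists A" "\<And>u. u \<in> S \<Longrightarrow> M \<notin> set u"
  shows "words_gf (join M S T) = var_x ^ M * var_y * words_gf S * words_gf T"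
proof (rule fps_ext)
  fix m
  define S' T' where "S' i = {\<sigma> \<in> S. length \<sigma> = i}" and "T' i = {\<sigma> \<in> T. length \<sigma> = i}" for i
  have fin: "finite (S' i)" "finite (T' i)" for i
    unfolding S'_def T'_def using assms finite_lists_length by blast+
  have inj: "inj_on (\<lambda>(u, v). u @ M # v) (S \<times> T)"
    using assms(4)
    by (auto simp: inj_on_def append_Cons_eq_append_Cons)
  have coeff: "fps_nth (var_x ^ M * var_y * words_gf S * words_gf T) m =
      (if m = 0 then 0 else fps_X ^ M * fps_nth (words_gf S * words_gf T) (m - 1))"
    unfolding fps_const_power mult.assoc by simp
  show "fps_nth (words_gf (join M S T)) m =
      fps_nth (var_x ^ M * var_y * words_gf S * words_gf T) m"
  proof (cases m)
    case 0
    have "{\<sigma> \<in> join M S T. length \<sigma> = 0} = {}"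
      by (auto simp: join_def)
    then show ?thesis
      using 0 coeff by (simp only: words_gf_nth) simp
  next
    case (Suc l)
    define I where "I = (SIGMA i : {0..l}. S' i \<times> T' (l - i))"
    have "bij_betw (\<lambda>(i, u, v). u @ M # v) I {\<sigma> \<in> join M S T. length \<sigma> = Suc l}"
      unfolding bij_betw_def
    proof
      show "inj_on (\<lambda>(i, u, v). u @ M # v) I"
        using inj by (auto simp: inj_on_def I_def S'_def T'_def)
      show "(\<lambda>(i, u, v). u @ M # v) ` I = {\<sigma> \<in> join M S T. length \<sigma> = Suc l}"
      proof (intro equalityI subsetI)
        fix \<sigma>
        assume "\<sigma> \<in> {\<sigma> \<in> join M S T. length \<sigma> = Suc l}"
        then obtain u v where "\<sigma> = u @ M # v" "(length u, u, v) \<in> I"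
          by (auto simp: join_def I_def S'_def T'_def)
        then show "\<sigma> \<in> (\<lambda>(i, u, v). u @ M # v) ` I"
          by force
      qed (auto simp: I_def S'_def T'_def join_def)
    qed
    then have "fps_nth (words_gf (join M S T)) (Suc l) =
        (\<Sum>(i, u, v) \<in> I. fps_X ^ M * (fps_X ^ sum_list u * fps_X ^ sum_list v))"
      unfolding words_gf_nth
      by (subst sum.reindex_bij_betw[symmetric])
        (auto simp: power_add split_beta mult_ac intro!: sum.cong)
    also have "\<dots> = (\<Sum>i = 0..l. \<Sum>u \<in> S' i. \<Sum>v \<in> T' (l - i).
        fps_X ^ M * (fps_X ^ sum_list u * fps_X ^ sum_list v))"
      using fin unfolding I_def by (subst sum.Sigma[symmetric]) (simp_all add: sum.cartesian_product)
    also have "\<dots> = fps_X ^ M * fps_nth (words_gf S * words_gf T) l"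
      by (simp only: fps_mult_nth words_gf_nth sum_product S'_def T'_def)
        (simp only: sum_distrib_left)
    finally show ?thesis
      unfolding coeff unfolding Suc by simp
  qed
qed

section \<open>The functional equation\<close>

context extreme_letter
begin

lemma lists_A_iff:
  "\<sigma> \<in> lists A \<longleftrightarrow> \<sigma> \<in> lists B \<or> (\<exists>w \<in> lists B. \<exists>r \<in> lists A. \<sigma> = w @ M # r)"
proof
  assume \<sigma>: "\<sigma> \<in> lists A"
  show "\<sigma> \<in> lists B \<or> (\<exists>w \<in> lists B. \<exists>r \<in> lists A. \<sigma> = w @ M # r)"
  proof (cases "M \<in> set \<sigma>")
    case True
    then obtain w r where "\<sigma> = w @ M # r" "M \<notin> set w"
      by (metis split_list_first)
    moreover from this have "w \<in> lists B" "r \<in> lists A"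
      using \<sigma> by (auto simp: in_lists_conv_set)
    ultimately show ?thesis
      by blast
  qed (use \<sigma> in \<open>auto simp: in_lists_conv_set\<close>)
qed auto

lemma lists_B_subset: "lists B \<subseteq> lists A"
  by (rule lists_mono) blast

lemma join_subset:
  assumes "S \<subseteq> lists B" "T \<subseteq> lists A"
  shows "join M S T \<subseteq> lists A"
proof -
  have "u @ M # v \<in> lists A" if "u \<in> S" "v \<in> T" for u v
    using that assms by (auto simp: subset_iff)
  then show ?thesis
    by (auto simp only: join_def)
qed

lemma join_disjoint: "F \<subseteq> lists B \<Longrightarrow> F \<inter> join M S T = {}"
  using M_notin by (auto simp: join_def)

lemma words_gf_disjoint_Un:
  "S \<subseteq> lists A \<Longrightarrow> T \<subseteq> lists A \<Longrightarrow> S \<inter> T = {} \<Longrightarrow> words_gf (S \<union> T) = words_gf S + words_gf T"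
  using finite_letters by (intro words_gf_Un[of A]) auto

lemma words_gf_join_lists:
  "S \<subseteq> lists B \<Longrightarrow> T \<subseteq> lists A \<Longrightarrow>
    words_gf (join M S T) = var_x ^ M * var_y * words_gf S * words_gf T"
  using finite_letters M_notin lists_B_subset by (intro words_gf_join[of A]) auto

text \<open>
  A word \<open>w M r\<close> avoids the shuffle pattern in one of two ways.  If \<open>w\<close> avoids \<open>\<tau>\<close>, then \<open>r\<close> may be
  any avoiding word.  Otherwise \<open>w\<close> is an avoiding word containing \<open>\<tau>\<close>, and \<open>r\<close> must lie in the
  set \<open>E\<close> of words all of whose occurrences of \<open>\<nu>\<close> use \<open>M\<close>; this already makes \<open>r\<close> avoid the
  shuffle pattern.  The set \<open>E\<close> has a decomposition of its own, which removes it from the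
  resulting equation.
\<close>

lemma words_gf_shuffle_avoiding:
  fixes \<tau> \<nu> :: "nat list"
  defines "C \<equiv> {\<sigma> \<in> lists A. \<not> shuffle_occurs R \<tau> \<nu> \<sigma>}"
    and "F \<equiv> {\<sigma> \<in> lists B. \<not> shuffle_occurs R \<tau> \<nu> \<sigma>}"
    and "T \<equiv> {\<sigma> \<in> lists B. \<not> contains \<tau> \<sigma>}"
    and "N \<equiv> {\<sigma> \<in> lists B. \<not> contains \<nu> \<sigma>}"
    and "z \<equiv> var_x ^ M * var_y"
  shows "words_gf C * ((1 - z * words_gf T) * (1 - z * words_gf N)) =
    words_gf F - z * words_gf T * words_gf N"
proof -
  define E where "E = {\<sigma> \<in> lists A. \<not> contains_below R \<nu> M \<sigma>}"
  have subsets: "F \<subseteq> lists B" "T \<subseteq> lists B" "N \<subseteq> lists B" "F - T \<subseteq> lists B"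
      "C \<subseteq> lists A" "E \<subseteq> lists A" "T \<subseteq> F"
    using shuffle_occurs_imp_contains by (auto simp: C_def F_def T_def N_def E_def)
  have "E \<subseteq> C"
    using shuffle_occurs_imp_contains_below unfolding E_def C_def by blast
  have C: "C = F \<union> (join M T C \<union> join M (F - T) E)"
  proof (intro set_eqI)
    fix \<sigma>
    have "w \<in> lists B \<and> r \<in> lists A \<and> \<not> shuffle_occurs R \<tau> \<nu> (w @ M # r) \<longleftrightarrow>
        w \<in> T \<and> r \<in> C \<or> w \<in> F - T \<and> r \<in> E" for w r
    proof (cases "w \<in> lists B \<and> r \<in> lists A")
      case True
      then show ?thesis
        using shuffle_occurs_split[of w r \<tau> \<nu>] \<open>T \<subseteq> F\<close> \<open>E \<subseteq> C\<close>
        by (auto simp: C_def F_def T_def E_def)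
    next
      case False
      then show ?thesis
        using subsets by blast
    qed
    moreover have "\<sigma> \<in> C \<longleftrightarrow> \<sigma> \<in> F \<or> (\<exists>w r. \<sigma> = w @ M # r \<and>
        w \<in> lists B \<and> r \<in> lists A \<and> \<not> shuffle_occurs R \<tau> \<nu> (w @ M # r))"
      unfolding C_def F_def using lists_A_iff[of \<sigma>] lists_B_subset by blast
    ultimately have "\<sigma> \<in> C \<longleftrightarrow> \<sigma> \<in> F \<or> (\<exists>w r. \<sigma> = w @ M # r \<and>
        (w \<in> T \<and> r \<in> C \<or> w \<in> F - T \<and> r \<in> E))"
      by presburger
    then show "\<sigma> \<in> C \<longleftrightarrow> \<sigma> \<in> F \<union> (join M T C \<union> join M (F - T) E)"
      by (auto simp: join_def)
  qed
  have "join M T C \<inter> join M (F - T) E = {}"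
  proof (rule equals0I)
    fix \<sigma>
    assume "\<sigma> \<in> join M T C \<inter> join M (F - T) E"
    then obtain w r w' r' where w: "w \<in> T" "w' \<in> F - T" "w @ M # r = w' @ M # r'"
      unfolding join_def by auto
    have "M \<notin> set w" "M \<notin> set w'"
      using w subsets M_notin by auto
    then show False
      using w by (simp add: append_Cons_eq_append_Cons)
  qed
  then have "words_gf C =
      words_gf F + (z * words_gf T * words_gf C + z * words_gf (F - T) * words_gf E)"
    using subsets lists_B_subset
    by (subst C) (simp add: z_def words_gf_disjoint_Un words_gf_join_lists join_subset join_disjoint
        Int_Un_distrib)
  moreover have "words_gf F = words_gf T + words_gf (F - T)"
    using subsets lists_B_subset words_gf_disjoint_Un[of T "F - T"] by (simp add: Un_absorb1)
  moreover have "E = N \<union> join M N E"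
  proof (intro set_eqI)
    fix \<sigma>
    have "w \<in> lists B \<and> r \<in> lists A \<and> \<not> contains_below R \<nu> M (w @ M # r) \<longleftrightarrow>
        w \<in> N \<and> r \<in> E" for w r
      using contains_below_cut[of M \<nu> w r] contains_below_M[of w \<nu>]
      unfolding N_def E_def by blast
    moreover have "\<sigma> \<in> E \<longleftrightarrow> \<sigma> \<in> N \<or> (\<exists>w r. \<sigma> = w @ M # r \<and>
        w \<in> lists B \<and> r \<in> lists A \<and> \<not> contains_below R \<nu> M (w @ M # r))"
      unfolding E_def N_def
      using lists_A_iff[of \<sigma>] lists_B_subset contains_below_M[of \<sigma> \<nu>] by blast
    ultimately have "\<sigma> \<in> E \<longleftrightarrow> \<sigma> \<in> N \<or> (\<exists>w r. \<sigma> = w @ M # r \<and> w \<in> N \<and> r \<in> E)"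
      by presburger
    then show "\<sigma> \<in> E \<longleftrightarrow> \<sigma> \<in> N \<union> join M N E"
      by (auto simp: join_def)
  qed
  then have "words_gf E = words_gf N + z * words_gf N * words_gf E"
    using subsets lists_B_subset words_gf_disjoint_Un[of N "join M N E"]
    by (simp add: z_def words_gf_join_lists join_subset join_disjoint)
  ultimately show ?thesis
    by algebra
qed

end

lemma eq_divide_fps:
  fixes f g h :: "rat fps fps"
  assumes "h * g = f" "fps_nth g 0 = 1"
  shows "h = f / g"
proof -
  have "g \<noteq> 0"
    using assms(2) by auto
  moreover have "f / g * g = h * g"
    using assms divide_mult_cancel_of_nth_0 by metis
  ultimately show ?thesis
    by simp
qed

lemma avoid_gf_shuffle:
  assumes "extreme_letter R B M"
    and avoids: "\<And>\<sigma>. avoids \<sigma> \<rho> \<longleftrightarrow> \<not> shuffle_occurs R \<tau> \<nu> \<sigma>"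
  shows "avoid_gf \<rho> (insert M B) =
       (avoid_gf \<rho> B - var_x ^ M * var_y * avoid_gf (consecutive_pop \<tau>) B
          * avoid_gf (consecutive_pop \<nu>) B)
       / ((1 - var_x ^ M * var_y * avoid_gf (consecutive_pop \<tau>) B)
          * (1 - var_x ^ M * var_y * avoid_gf (consecutive_pop \<nu>) B))"
proof (rule eq_divide_fps)
  interpret extreme_letter R B M
    by fact
  show "avoid_gf \<rho> (insert M B) * ((1 - var_x ^ M * var_y * avoid_gf (consecutive_pop \<tau>) B)
          * (1 - var_x ^ M * var_y * avoid_gf (consecutive_pop \<nu>) B)) =
      avoid_gf \<rho> B - var_x ^ M * var_y * avoid_gf (consecutive_pop \<tau>) B
          * avoid_gf (consecutive_pop \<nu>) B"
    using words_gf_shuffle_avoiding[of \<tau> \<nu>] finite_letters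
    by (simp only: avoid_gf_eq_words_gf finite_insert avoids avoids_consecutive_iff not_not)
qed (simp add: mult.assoc)

theorem theorem3p3:
  fixes a :: "nat \<Rightarrow> nat" and A :: "nat set" and k t u :: nat and \<tau> \<nu> :: "nat list"
  assumes "strict_mono_on {1..k} a"
    and "\<And>i. i \<in> {1..k} \<Longrightarrow> 0 < a i"
    and "A = a ` {1..k}"
    and "consecutive_word t \<tau>"
    and "consecutive_word u \<nu>"
    and "k \<ge> max t u + 1"
  shows
    "avoid_gf (shuffle_greatest \<tau> \<nu>) A =
       (avoid_gf (shuffle_greatest \<tau> \<nu>) (A - {a k})
          - var_x ^ a k * var_y * avoid_gf (consecutive_pop \<tau>) (A - {a k})
              * avoid_gf (consecutive_pop \<nu>) (A - {a k}))
       / ((1 - var_x ^ a k * var_y * avoid_gf (consecutive_pop \<tau>) (A - {a k}))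
          * (1 - var_x ^ a k * var_y * avoid_gf (consecutive_pop \<nu>) (A - {a k})))
     \<and>
     avoid_gf (shuffle_smallest \<tau> \<nu>) A =
       (avoid_gf (shuffle_smallest \<tau> \<nu>) (A - {a 1})
          - var_x ^ a 1 * var_y * avoid_gf (consecutive_pop \<tau>) (A - {a 1})
              * avoid_gf (consecutive_pop \<nu>) (A - {a 1}))
       / ((1 - var_x ^ a 1 * var_y * avoid_gf (consecutive_pop \<tau>) (A - {a 1}))
          * (1 - var_x ^ a 1 * var_y * avoid_gf (consecutive_pop \<nu>) (A - {a 1})))"
proof -
  have k: "1 \<in> {1..k}" "k \<in> {1..k}"
    using assms(6) by auto
  have strict: "a i < a j" if "i \<in> {1..k}" "j \<in> {1..k}" "i < j" for i j
    using strict_mono_onD[OF assms(1) that] .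
  have "extreme_letter (<) (A - {a k}) (a k)"
  proof
    fix b
    assume "b \<in> A - {a k}"
    then obtain i where "i \<in> {1..k}" "b = a i" "i \<noteq> k"
      using assms(3) by blast
    then show "b < a k"
      using strict k by auto
  qed (use assms(3) in auto)
  moreover have "extreme_letter (>) (A - {a 1}) (a 1)"
  proof
    fix b
    assume "b \<in> A - {a 1}"
    then obtain i where "i \<in> {1..k}" "b = a i" "i \<noteq> 1"
      using assms(3) by blast
    then show "b > a 1"
      using strict k by auto
  qed (use assms(3) in \<open>auto simp: irreflp_def transp_def\<close>)
  moreover have "insert (a k) (A - {a k}) = A" "insert (a 1) (A - {a 1}) = A"
    using assms(3) k by auto
  ultimately show ?thesis
    using avoid_gf_shuffle[OF _ avoids_shuffle_greatest_iff]
      avoid_gf_shuffle[OF _ avoids_shuffle_smallest_iff]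
    by metis
qed

end
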